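(* Let $\mathcal{R}$ be a finite simple Lie conformal superalgebra over $\mathbb{C}$. Then every conformal triple derivation of $\mathcal{R}$ is a conformal derivation and conversely, i.e. $CTDer(\mathcal{R})=CDer(\mathcal{R})$.
   Context: All vector spaces are over $\mathbb{C}$. A Lie conformal superalgebra is a $\mathbb{Z}_2$-graded $\mathbb{C}[\partial]$-module $\mathcal{R}=\mathcal{R}_{\bar 0}\oplus\mathcal{R}_{\bar 1}$ with a $\mathbb{C}$-linear map $\mathcal{R}\otimes\mathcal{R}\to\mathbb{C}[\lambda]\otimes\mathcal{R}$, $a\otimes b\mapsto[a_\lambda b]$, compatible with the grading (the bracket of elements of parities $i,j$ has coefficients of parity $i+j$), such that for homogeneous $a,b,c$ (with parities $|a|,|b|,|c|$): $[\partial a_\lambda b]=-\lambda[a_\lambda b]$, $[a_\lambda\partial b]=(\partial+\lambda)[a_\lambda b]$; $[a_\lambda b]=-(-1)^{|a||b|}[b_{-\lambda-\partial}a]$; $[a_\lambda[b_\mu c]]=[[a_\lambda b]_{\lambda+\mu}c]+(-1)^{|a||b|}[b_\mu[a_\lambda c]]$. Writing $[a_\lambda b]=\sum_n\frac{\lambda^n}{n!}a_{(n)}b$, an ideal is a $\mathbb{C}[\partial]$-submodule $\mathcal I$ with $a_{(n)}\mathcal I\subseteq\mathcal I$ for all $a\in\mathcal R$, $n\ge 0$. $\mathcal{R}$ is finite if it is finitely generated as a $\mathbb{C}[\partial]$-module, and simple if it is not abelian (its bracket is not identically zero) and has no non-trivial ideals. A conformal linear map of degree $\alpha\in\{\bar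 0,\bar 1\}$ on $\mathcal{R}$ is a $\mathbb{C}$-linear map $\phi_x:\mathcal{R}\to\mathbb{C}[x]\otimes\mathcal{R}$ with $\phi_x(\partial a)=(\partial+x)\phi_x(a)$ and $\phi_x(\mathcal{R}_\beta)\subseteq\mathcal{R}_{\alpha+\beta}[x]$; write $|\phi|=\alpha$. Brackets and conformal linear maps are extended coefficientwise to polynomials in the formal variables. A conformal linear map $\phi_x$ of degree $\alpha$ is a conformal derivation of degree $\alpha$ if $\phi_x([a_\mu b])=[\phi_x(a)_{x+\mu}b]+(-1)^{|\phi||a|}[a_\mu\phi_x(b)]$ for all homogeneous $a,b$. It is a conformal triple derivation of degree $\alpha$ if for all homogeneous $a,b,c$ $$\phi_x([[a_\lambda b]_{\lambda+\mu}c])=[[\phi_x(a)_{\lambda+x}b]_{\lambda+\mu+x}c]+(-1)^{|\phi||a|}[[a_\lambda\phi_x(b)]_{\lambda+\mu+x}c]+(-1)^{|\phi|(|a|+|b|)}[[a_\lambda b]_{\lambda+\mu}\phi_x(c)].$$ $CDer(\mathcal{R})$ (resp. $CTDer(\mathcal{R})$) is the direct sum over $\alpha\in\{\bar0,\bar1\}$ of the spaces of conformal derivations (resp. conformal triple derivations) of degree $\alpha$. *)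

theory Defs
  imports
    "HOL-Library.Z2"
    "HOL-Library.Poly_Mapping"
    "HOL-Computational_Algebra.Polynomial"
begin

text \<open>
  A \<open>\<complex>[\<partial>]\<close>-module is an instance of the library locale \<^locale>\<open>module\<close> over the ring
  \<^typ>\<open>complex poly\<close>; the underlying complex vector space structure is the action of the
  constant polynomials, and \<open>\<partial>\<close> is the action of the polynomial variable.
\<close>

abbreviation cmult :: "(complex poly \<Rightarrow> 'a \<Rightarrow> 'a) \<Rightarrow> complex \<Rightarrow> 'a \<Rightarrow> 'a"
  where "cmult act c \<equiv> act [:c:]"

abbreviation partial :: "(complex poly \<Rightarrow> 'a \<Rightarrow> 'a) \<Rightarrow> 'a \<Rightarrow> 'a"
  where "partial act \<equiv> act [:0, 1:]"

text \<open>
  Values of a \<open>\<lambda>\<close>-bracket and of a conformal linear map are one-variable polynomials with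
  coefficients in \<open>\<R>\<close>, of type \<^typ>\<open>'a poly\<close>; multiplication by the variable is
  \<^term>\<open>pCons 0\<close>. Identities that involve several formal variables are stated in
  \<open>\<R>[\<lambda>,\<mu>,x]\<close>, i.e. for finitely supported functions from monomials to \<open>\<R>\<close>.
\<close>

datatype fvar = Lam | Mu | Ex

type_synonym 'a fpoly = "(fvar \<Rightarrow>\<^sub>0 nat) \<Rightarrow>\<^sub>0 'a"

definition const :: "'a::zero \<Rightarrow> 'a fpoly"
  where "const a = Poly_Mapping.single 0 a"

definition mono_mult :: "(fvar \<Rightarrow>\<^sub>0 nat) \<Rightarrow> 'a::comm_monoid_add fpoly \<Rightarrow> 'a fpoly"
  where "mono_mult m u =
    (\<Sum>k\<in>Poly_Mapping.keys u. Poly_Mapping.single (m + k) (Poly_Mapping.lookup u k))"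

text \<open>Multiplication by the linear form that is the sum of the variables in \<open>V\<close>.\<close>

definition lin_mult :: "fvar set \<Rightarrow> 'a::comm_monoid_add fpoly \<Rightarrow> 'a fpoly"
  where "lin_mult V u = (\<Sum>v\<in>V. mono_mult (Poly_Mapping.single v 1) u)"

text \<open>
  Substitution of an operator \<open>T\<close> on \<open>\<R>[\<lambda>,\<mu>,x]\<close> for the variable of a polynomial
  \<open>p = \<Sum>\<^sub>n t\<^sup>n p\<^sub>n\<close>, giving \<open>\<Sum>\<^sub>n T\<^sup>n p\<^sub>n\<close>. Operators rather than scalar polynomials are needed
  for the substitution \<open>-\<lambda>-\<partial>\<close>, where powers of \<open>\<partial>\<close> act on the coefficients.
\<close>

definition psubst :: "('a fpoly \<Rightarrow> 'a fpoly) \<Rightarrow> 'a::comm_monoid_add poly \<Rightarrow> 'a fpoly"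
  where "psubst T p = (\<Sum>n\<le>Polynomial.degree p. (T ^^ n) (const (coeff p n)))"

text \<open>
  The bracket \<open>[u\<^sub>t v]\<close> for \<open>u, v \<in> \<R>[\<lambda>,\<mu>,x]\<close>, extended coefficientwise, where \<open>t\<close> is the
  sum of the variables in \<open>V\<close>.
\<close>

definition fbr ::
    "('a \<Rightarrow> 'a \<Rightarrow> 'a poly) \<Rightarrow> fvar set \<Rightarrow> 'a::comm_monoid_add fpoly \<Rightarrow> 'a fpoly \<Rightarrow> 'a fpoly"
  where "fbr br V u v =
    (\<Sum>k\<in>Poly_Mapping.keys u. \<Sum>l\<in>Poly_Mapping.keys v.
       mono_mult (k + l)
         (psubst (lin_mult V) (br (Poly_Mapping.lookup u k) (Poly_Mapping.lookup v l))))"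

text \<open>The coefficientwise extension of a map \<open>\<phi>\<^sub>x\<close> to \<open>\<R>[\<lambda>,\<mu>,x]\<close>.\<close>

definition fmap :: "('a \<Rightarrow> 'a poly) \<Rightarrow> 'a::comm_monoid_add fpoly \<Rightarrow> 'a fpoly"
  where "fmap \<phi> u =
    (\<Sum>k\<in>Poly_Mapping.keys u.
       mono_mult k (psubst (lin_mult {Ex}) (\<phi> (Poly_Mapping.lookup u k))))"

text \<open>Multiplication by the sign \<open>(-1)\<^sup>p\<close>, for a parity \<open>p \<in> \<int>/2\<int>\<close>.\<close>

definition psign :: "bit \<Rightarrow> 'm::ab_group_add \<Rightarrow> 'm"
  where "psign p u = (if p = 1 then - u else u)"

locale lie_conformal_superalgebra = module act
  for act :: "complex poly \<Rightarrow> 'a::ab_group_add \<Rightarrow> 'a" +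
  fixes gr :: "bit \<Rightarrow> 'a set"
    and br :: "'a \<Rightarrow> 'a \<Rightarrow> 'a poly"
  assumes gr_submodule: "subspace (gr i)"
    and gr_inter: "gr 0 \<inter> gr 1 = {0}"
    and gr_sum: "\<exists>a0\<in>gr 0. \<exists>a1\<in>gr 1. a = a0 + a1"
    and br_add_left: "br (a + a') b = br a b + br a' b"
    and br_add_right: "br a (b + b') = br a b + br a b'"
    and br_cmult_left: "br (cmult act c a) b = map_poly (cmult act c) (br a b)"
    and br_cmult_right: "br a (cmult act c b) = map_poly (cmult act c) (br a b)"
    and br_graded: "a \<in> gr i \<Longrightarrow> b \<in> gr j \<Longrightarrow> coeff (br a b) n \<in> gr (i + j)"
    and br_partial_left: "br (partial act a) b = - pCons 0 (br a b)"
    and br_partial_right: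
      "br a (partial act b) = map_poly (partial act) (br a b) + pCons 0 (br a b)"
    and skew_symmetry: "a \<in> gr i \<Longrightarrow> b \<in> gr j \<Longrightarrow>
      fbr br {Lam} (const a) (const b) =
        - psign (i * j)
            (psubst (\<lambda>u. - lin_mult {Lam} u - Poly_Mapping.map (partial act) u) (br b a))"
    and jacobi: "a \<in> gr i \<Longrightarrow> b \<in> gr j \<Longrightarrow> c' \<in> gr k \<Longrightarrow>
      fbr br {Lam} (const a) (fbr br {Mu} (const b) (const c')) =
        fbr br {Lam, Mu} (fbr br {Lam} (const a) (const b)) (const c')
        + psign (i * j) (fbr br {Mu} (const b) (fbr br {Lam} (const a) (const c')))"
begin

definition nprod :: "nat \<Rightarrow> 'a \<Rightarrow> 'a \<Rightarrow> 'a"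
  where "nprod n a b = cmult act (fact n) (coeff (br a b) n)"

definition ideal :: "'a set \<Rightarrow> bool"
  where "ideal I \<longleftrightarrow> subspace I \<and> (\<forall>a n. \<forall>b\<in>I. nprod n a b \<in> I)"

definition fin_gen :: bool
  where "fin_gen \<longleftrightarrow> (\<exists>S. finite S \<and> span S = UNIV)"

definition abelian :: bool
  where "abelian \<longleftrightarrow> (\<forall>a b. br a b = 0)"

definition simple :: bool
  where "simple \<longleftrightarrow> \<not> abelian \<and> (\<forall>I. ideal I \<longrightarrow> I = {0} \<or> I = UNIV)"

definition conformal_linear :: "bit \<Rightarrow> ('a \<Rightarrow> 'a poly) \<Rightarrow> bool"
  where "conformal_linear \<alpha> \<phi> \<longleftrightarrow>
    (\<forall>a b. \<phi> (a + b) = \<phi> a + \<phi> b) \<and>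
    (\<forall>c a. \<phi> (cmult act c a) = map_poly (cmult act c) (\<phi> a)) \<and>
    (\<forall>a. \<phi> (partial act a) = map_poly (partial act) (\<phi> a) + pCons 0 (\<phi> a)) \<and>
    (\<forall>\<beta>. \<forall>a\<in>gr \<beta>. \<forall>n. coeff (\<phi> a) n \<in> gr (\<alpha> + \<beta>))"

definition conformal_derivation :: "bit \<Rightarrow> ('a \<Rightarrow> 'a poly) \<Rightarrow> bool"
  where "conformal_derivation \<alpha> \<phi> \<longleftrightarrow> conformal_linear \<alpha> \<phi> \<and>
    (\<forall>i j. \<forall>a\<in>gr i. \<forall>b\<in>gr j.
       fmap \<phi> (fbr br {Mu} (const a) (const b)) =
         fbr br {Ex, Mu} (fmap \<phi> (const a)) (const b)
         + psign (\<alpha> * i) (fbr br {Mu} (const a) (fmap \<phi> (const b))))"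

definition conformal_triple_derivation :: "bit \<Rightarrow> ('a \<Rightarrow> 'a poly) \<Rightarrow> bool"
  where "conformal_triple_derivation \<alpha> \<phi> \<longleftrightarrow> conformal_linear \<alpha> \<phi> \<and>
    (\<forall>i j k. \<forall>a\<in>gr i. \<forall>b\<in>gr j. \<forall>c\<in>gr k.
       fmap \<phi> (fbr br {Lam, Mu} (fbr br {Lam} (const a) (const b)) (const c)) =
         fbr br {Lam, Mu, Ex} (fbr br {Lam, Ex} (fmap \<phi> (const a)) (const b)) (const c)
         + psign (\<alpha> * i)
             (fbr br {Lam, Mu, Ex} (fbr br {Lam} (const a) (fmap \<phi> (const b))) (const c))
         + psign (\<alpha> * (i + j))
             (fbr br {Lam, Mu} (fbr br {Lam} (const a) (const b)) (fmap \<phi> (const c))))"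

definition CDer :: "('a \<Rightarrow> 'a poly) set"
  where "CDer = {\<lambda>a. \<phi>0 a + \<phi>1 a | \<phi>0 \<phi>1.
    conformal_derivation 0 \<phi>0 \<and> conformal_derivation 1 \<phi>1}"

definition CTDer :: "('a \<Rightarrow> 'a poly) set"
  where "CTDer = {\<lambda>a. \<phi>0 a + \<phi>1 a | \<phi>0 \<phi>1.
    conformal_triple_derivation 0 \<phi>0 \<and> conformal_triple_derivation 1 \<phi>1}"

end

end

theory Submission
  imports Defs
begin

text \<open>
  Evaluating the formal variables at complex numbers loses no information, so all identities can
  be treated as identities in the algebra itself. Let \<open>D(a,b)\<close> measure the failure of a triple
  derivation \<open>\<phi>\<close> to be a derivation on \<open>[a,b]\<close> (signs and variables suppressed). The triple
  derivation property says \<open>D([a,b],c) = -[D(a,b),c]\<close>, and skew-symmetry turns this into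
  \<open>D(c,[a,b]) = -[c,D(a,b)]\<close>. As the centre is zero, \<open>D(a,b)\<close> depends only on \<open>[a,b]\<close>, whence
  the Jacobi identity gives \<open>D(a,[b,c]) = D([a,b],c) + D(b,[a,c])\<close>. If \<open>a = [a1,a2]\<close>, the Jacobi
  identity for \<open>D(a1,a2)\<close>, \<open>b\<close>, \<open>c\<close> gives the same equation with the opposite sign on the left.
  Hence \<open>D(a,[b,c]) = 0\<close>, and \<open>D = 0\<close> because the algebra is perfect.
\<close>

section \<open>Submodules over \<complex>[\<partial>] and evaluation of formal polynomials\<close>

locale complex_poly_module = module act
  for act :: "complex poly \<Rightarrow> 'a::ab_group_add \<Rightarrow> 'a"
begin

text \<open>Constants and \<partial> generate \<complex>[\<partial>], so closure under these two
  actions suffices.\<close>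

lemma subspace_if_closed_partial:
  assumes "0 \<in> S" and "\<And>u v. u \<in> S \<Longrightarrow> v \<in> S \<Longrightarrow> u + v \<in> S"
    and "\<And>c u. u \<in> S \<Longrightarrow> cmult act c u \<in> S" and "\<And>u. u \<in> S \<Longrightarrow> partial act u \<in> S"
  shows "subspace S"
proof -
  have "act p u \<in> S" if "u \<in> S" for p u
  proof (induction p)
    case (pCons c p)
    have "act (pCons c p) u = cmult act c u + partial act (act p u)"
      by (simp flip: scale_left_distrib)
    then show ?case
      using assms that pCons by (simp del: scale_scale)
  qed (use assms in simp)
  then show ?thesis
    using assms by (auto simp: subspace_def)
qed

lemma subspace_sums:
  assumes S: "subspace S" and T: "subspace T"
  shows "subspace {u + v | u v. u \<in> S \<and> v \<in> T}"
proof (rule subspaceI)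
  show "0 \<in> {u + v | u v. u \<in> S \<and> v \<in> T}"
    using subspace_0[OF S] subspace_0[OF T] by force
next
  fix a b
  assume "a \<in> {u + v | u v. u \<in> S \<and> v \<in> T}" "b \<in> {u + v | u v. u \<in> S \<and> v \<in> T}"
  then obtain u v u' v' where "u \<in> S" "v \<in> T" "a = u + v" "u' \<in> S" "v' \<in> T" "b = u' + v'"
    by blast
  then have "a + b = (u + u') + (v + v')" "u + u' \<in> S" "v + v' \<in> T"
    by (simp_all add: ac_simps subspace_add S T)
  then show "a + b \<in> {u + v | u v. u \<in> S \<and> v \<in> T}"
    by blast
next
  fix p a
  assume "a \<in> {u + v | u v. u \<in> S \<and> v \<in> T}"
  then show "act p a \<in> {u + v | u v. u \<in> S \<and> v \<in> T}"
    using S T by (force simp: scale_right_distrib intro: subspace_scale)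
qed

lemma cmult_sum: "cmult act (sum f A) v = (\<Sum>i\<in>A. cmult act (f i) v)"
  by (simp add: monom_sum scale_sum_left flip: monom_0)

text \<open>Lagrange interpolation: power sums with pairwise distinct nodes determine each summand,
  and do so modulo any submodule.\<close>

lemma vandermonde_subspace:
  assumes S: "subspace S" and fin: "finite K" and inj: "inj_on d K"
    and mem: "\<And>j::nat. (\<Sum>k\<in>K. cmult act (d k ^ j) (u k)) \<in> S" and k: "k \<in> K"
  shows "u k \<in> S"
proof -
  have poly_mem: "(\<Sum>l\<in>K. cmult act (poly q (d l)) (u l)) \<in> S" for q
  proof -
    have "(\<Sum>l\<in>K. cmult act (poly q (d l)) (u l)) =
        (\<Sum>l\<in>K. \<Sum>j\<le>degree q. cmult act (coeff q j) (cmult act (d l ^ j) (u l)))"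
      by (intro sum.cong refl)
        (simp add: poly_altdef cmult_sum mult.commute)
    also have "\<dots> = (\<Sum>j\<le>degree q. cmult act (coeff q j) (\<Sum>l\<in>K. cmult act (d l ^ j) (u l)))"
      by (subst sum.swap) (simp add: scale_sum_right)
    finally show ?thesis
      using mem S by (simp add: subspace_sum subspace_scale)
  qed
  \<comment> \<open>The interpolation polynomial vanishing at every node except \<open>d k\<close>,
    which isolates the summand \<open>u k\<close> up to a nonzero scalar.\<close>
  define q where "q = (\<Prod>l\<in>K - {k}. [:- d l, 1:])"
  have q_other: "poly q (d l) = 0" if "l \<in> K - {k}" for l
    using that fin by (auto simp: q_def poly_prod)
  have q_k: "poly q (d k) \<noteq> 0"
    using fin inj k by (auto simp: q_def poly_prod inj_on_def)
  have "(\<Sum>l\<in>K. cmult act (poly q (d l)) (u l)) = cmult act (poly q (d k)) (u k)"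
    using fin k q_other by (subst sum.remove[of _ k]) auto
  then have "cmult act (inverse (poly q (d k))) (cmult act (poly q (d k)) (u k)) \<in> S"
    using poly_mem[of q] S by (metis subspace_scale)
  then show ?thesis
    using q_k by (simp flip: one_pCons)
qed

text \<open>The evaluation point lies in \<complex>[\<partial>] rather than in \<complex>, so that
  the substitution of -\<lambda>-\<partial> in skew-symmetry is also an evaluation, at
  \<open>[:- l, - 1:]\<close>.\<close>

definition ev :: "complex poly \<Rightarrow> 'a poly \<Rightarrow> 'a"
  where "ev t p = (\<Sum>n\<le>degree p. act (t ^ n) (coeff p n))"

lemma ev_altdef: "degree p \<le> N \<Longrightarrow> ev t p = (\<Sum>n\<le>N. act (t ^ n) (coeff p n))"
  unfolding ev_def by (rule sum.mono_neutral_left) (auto simp: coeff_eq_0)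

lemma ev_0 [simp]: "ev t 0 = 0"
  by (simp add: ev_def)

lemma ev_add: "ev t (p + q) = ev t p + ev t q"
proof -
  define N where "N = max (degree p) (degree q)"
  have "degree p \<le> N" "degree q \<le> N" "degree (p + q) \<le> N"
    by (auto simp: N_def degree_add_le)
  then show ?thesis
    by (simp add: ev_altdef[of _ N] scale_right_distrib sum.distrib)
qed

lemma ev_minus: "ev t (- p) = - ev t p"
  by (simp add: ev_def sum_negf)

lemma ev_diff: "ev t (p - q) = ev t p - ev t q"
  using ev_add[of t p "- q"] by (simp add: ev_minus)

lemma ev_psign: "ev t (psign i p) = psign i (ev t p)"
  by (simp add: psign_def ev_minus)

lemma ev_pCons: "ev t (pCons a p) = a + act t (ev t p)"
proof -
  have "ev t (pCons a p) = (\<Sum>n\<le>Suc (degree p). act (t ^ n) (coeff (pCons a p) n))"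
    by (rule ev_altdef) (simp add: degree_pCons_le)
  also have "\<dots> = a + (\<Sum>n\<le>degree p. act (t ^ Suc n) (coeff p n))"
    by (subst sum.atMost_Suc_shift) simp
  finally show ?thesis
    by (simp add: ev_def scale_sum_right)
qed

text \<open>Only additivity and an intertwining of \<open>t\<close> with \<open>t'\<close> are
  required, because \<phi> at a complex value x does not commute with \<partial> but carries it to
  \<partial>+x.\<close>

lemma ev_map_poly:
  assumes add: "\<And>u v. f (u + v) = f u + f v" and f_act: "\<And>u. f (act t u) = act t' (f u)"
  shows "ev t' (map_poly f p) = f (ev t p)"
proof -
  have f0: "f 0 = 0"
    using add[of 0 0] by simp
  show ?thesis
    by (induction p) (simp_all add: f0 map_poly_pCons ev_pCons add f_act)
qed

lemma ev_map_poly_act: "ev t (map_poly (act r) p) = act r (ev t p)"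
  by (rule ev_map_poly) (auto simp: scale_right_distrib mult.commute)

text \<open>The translate of a polynomial is again a polynomial, and one \<open>q\<close> serves all
  points \<open>t\<close> of \<complex>[\<partial>]. An identity known at complex points can thus be
  transported to points involving \<partial>.\<close>

lemma ev_shift: "\<exists>q. \<forall>t. ev t q = ev (t + [:x:]) p"
proof (induction p)
  case 0
  show ?case by (auto intro: exI[of _ 0])
next
  case (pCons a p)
  then obtain q where q: "\<And>t. ev t q = ev (t + [:x:]) p" by blast
  have "ev t (pCons a q + map_poly (cmult act x) q) = ev (t + [:x:]) (pCons a p)" for t
    by (simp add: ev_add ev_pCons q ev_map_poly_act scale_right_distrib
        scale_left_distrib scale_left_commute ac_simps del: scale_scale)
  then show ?case by blast
qed

text \<open>At the points \<open>2 ^ j\<close> the values are power sums in the distinct nodes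
  \<open>2 ^ n\<close>, so interpolation recovers the coefficients.\<close>

lemma coeff_in_subspace_if_ev:
  assumes S: "subspace S" and mem: "\<And>c. ev [:c:] p \<in> S"
  shows "coeff p n \<in> S"
proof (cases "n \<le> degree p")
  case True
  show ?thesis
  proof (rule vandermonde_subspace[OF S, of "{..degree p}" "\<lambda>n. 2 ^ n"])
    show "inj_on (\<lambda>n. 2 ^ n :: complex) {..degree p}"
    proof (rule inj_onI)
      fix m n :: nat
      assume "(2 :: complex) ^ m = 2 ^ n"
      then have "of_nat (2 ^ m) = (of_nat (2 ^ n) :: complex)" by simp
      then show "m = n" by (simp only: of_nat_eq_iff) simp
    qed
    fix j :: nat
    show "(\<Sum>k\<le>degree p. cmult act ((2 ^ k) ^ j) (coeff p k)) \<in> S"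
      using mem[of "2 ^ j"]
      by (simp add: ev_def poly_const_pow flip: power_mult) (simp add: mult.commute)
  qed (use True in auto)
qed (use S in \<open>simp add: coeff_eq_0 subspace_0\<close>)

lemma poly_eqI_ev:
  assumes "\<And>c. ev [:c:] p = ev [:c:] q"
  shows "p = q"
proof -
  have "coeff (p - q) n \<in> {0}" for n
    by (rule coeff_in_subspace_if_ev) (auto simp: subspace_single_0 ev_diff assms)
  then show ?thesis
    by (intro poly_eqI) auto
qed

section \<open>Evaluation in the three variables \<lambda>, \<mu>, x\<close>

definition mval :: "(fvar \<Rightarrow> complex) \<Rightarrow> (fvar \<Rightarrow>\<^sub>0 nat) \<Rightarrow> complex"
  where "mval s k = s Lam ^ Poly_Mapping.lookup k Lam * s Mu ^ Poly_Mapping.lookup k Mu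
    * s Ex ^ Poly_Mapping.lookup k Ex"

definition fev :: "(fvar \<Rightarrow> complex) \<Rightarrow> 'a fpoly \<Rightarrow> 'a"
  where "fev s u = (\<Sum>k\<in>Poly_Mapping.keys u. cmult act (mval s k) (Poly_Mapping.lookup u k))"

lemma mval_0 [simp]: "mval s 0 = 1"
  by (simp add: mval_def)

lemma mval_add: "mval s (k + l) = mval s k * mval s l"
  by (simp add: mval_def lookup_add power_add)

lemma mval_single: "mval s (Poly_Mapping.single v 1) = s v"
  by (cases v) (simp_all add: mval_def lookup_single)

lemma fev_altdef:
  "finite A \<Longrightarrow> Poly_Mapping.keys u \<subseteq> A \<Longrightarrow>
    fev s u = (\<Sum>k\<in>A. cmult act (mval s k) (Poly_Mapping.lookup u k))"
  unfolding fev_def by (rule sum.mono_neutral_left) (auto simp: in_keys_iff)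

lemma fev_0 [simp]: "fev s 0 = 0"
  by (simp add: fev_def)

lemma fev_add: "fev s (u + v) = fev s u + fev s v"
  unfolding fev_def by (rule setsum_keys_plus_distrib) (auto simp: scale_right_distrib)

lemma fev_minus: "fev s (- u) = - fev s u"
  using fev_add[of s u "- u"] by (simp add: eq_neg_iff_add_eq_0 add.commute)

lemma fev_diff: "fev s (u - v) = fev s u - fev s v"
  using fev_add[of s u "- v"] by (simp add: fev_minus)

lemma fev_sum: "fev s (sum f A) = (\<Sum>i\<in>A. fev s (f i))"
  by (induction A rule: infinite_finite_induct) (auto simp: fev_add)

lemma fev_psign: "fev s (psign p u) = psign p (fev s u)"
  by (simp add: psign_def fev_minus)

lemma fev_single: "fev s (Poly_Mapping.single k a) = cmult act (mval s k) a"
  by (subst fev_altdef[of "{k}"]) auto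

lemma fev_const [simp]: "fev s (const a) = a"
  by (simp add: const_def fev_single flip: one_pCons)

lemma fev_mono_mult: "fev s (mono_mult m u) = cmult act (mval s m) (fev s u)"
  by (simp add: mono_mult_def fev_sum fev_single mval_add fev_def[of s u] scale_sum_right mult.commute)

lemma fev_lin_mult: "fev s (lin_mult V u) = cmult act (sum s V) (fev s u)"
  by (simp add: lin_mult_def fev_sum fev_mono_mult mval_single[simplified] cmult_sum)

lemma fev_map:
  "fev s (Poly_Mapping.map (partial act) u) = partial act (fev s u)"
proof -
  have "Poly_Mapping.keys (Poly_Mapping.map (partial act) u) \<subseteq> Poly_Mapping.keys u"
    by (auto simp: in_keys_iff map.rep_eq)
  then show ?thesis
    by (auto simp: fev_altdef[of "Poly_Mapping.keys u"] map.rep_eq in_keys_iff scale_sum_right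
        intro!: sum.cong)
qed

text \<open>The hypothesis says that \<open>T\<close> becomes the action of \<open>t\<close> after
  evaluation; this covers both sums of variables and the operator -\<lambda>-\<partial>.\<close>

lemma fev_psubst:
  assumes "\<And>u. fev s (T u) = act t (fev s u)"
  shows "fev s (psubst T p) = ev t p"
proof -
  have "fev s ((T ^^ n) u) = act (t ^ n) (fev s u)" for n u
    by (induction n) (auto simp: assms)
  then show ?thesis
    by (simp add: psubst_def ev_def fev_sum)
qed

lemma fev_psubst_lin_mult: "fev s (psubst (lin_mult V) p) = ev [:sum s V:] p"
  by (rule fev_psubst) (rule fev_lin_mult)

text \<open>
  Evaluating at \<open>(2\<^sup>j, 3\<^sup>j, 5\<^sup>j)\<close> for all \<open>j\<close> turns distinct monomials into powers of distinct
  numbers, by unique factorization.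
\<close>

lemma fpoly_eqI_fev:
  assumes "\<And>s. fev s u = fev s v"
  shows "u = v"
proof -
  define s :: "nat \<Rightarrow> fvar \<Rightarrow> complex" where
    "s j = (\<lambda>w. case w of Lam \<Rightarrow> 2 ^ j | Mu \<Rightarrow> 3 ^ j | Ex \<Rightarrow> 5 ^ j)" for j
  define m :: "(fvar \<Rightarrow>\<^sub>0 nat) \<Rightarrow> nat"
    where "m k = 2 ^ Poly_Mapping.lookup k Lam * 3 ^ Poly_Mapping.lookup k Mu
      * 5 ^ Poly_Mapping.lookup k Ex" for k
  have mval_s: "mval (s j) k = of_nat (m k) ^ j" for j k
    by (simp add: mval_def s_def m_def power_mult_distrib flip: power_mult) (simp add: mult.commute)
  have m_inj: "k = l" if "m k = m l" for k l
  proof -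
    have mult: "multiplicity 2 (m k) = Poly_Mapping.lookup k Lam"
      "multiplicity 3 (m k) = Poly_Mapping.lookup k Mu"
      "multiplicity 5 (m k) = Poly_Mapping.lookup k Ex" for k
      by (simp_all add: m_def prime_elem_multiplicity_mult_distrib
          prime_elem_multiplicity_power_distrib multiplicity_same_power
          prime_multiplicity_other)
    have "Poly_Mapping.lookup k w = Poly_Mapping.lookup l w" for w
      using that by (cases w) (simp_all flip: mult)
    then show ?thesis by (intro poly_mapping_eqI)
  qed
  have "Poly_Mapping.lookup (u - v) k \<in> {0}" if "k \<in> Poly_Mapping.keys (u - v)" for k
  proof (rule vandermonde_subspace[of _ "Poly_Mapping.keys (u - v)" "\<lambda>k. of_nat (m k)"])
    show "inj_on (\<lambda>k. of_nat (m k) :: complex) (Poly_Mapping.keys (u - v))"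
      by (auto intro!: inj_onI m_inj)
    show "(\<Sum>k\<in>Poly_Mapping.keys (u - v). cmult act (of_nat (m k) ^ j)
        (Poly_Mapping.lookup (u - v) k)) \<in> {0}" for j
      using fev_diff[of "s j" u v] assms by (simp add: fev_def[of _ "u - v"] mval_s)
  qed (use that in \<open>auto simp: subspace_single_0\<close>)
  then have "u - v = 0"
    by (intro poly_mapping_eqI) (metis in_keys_iff lookup_zero singletonD)
  then show ?thesis by simp
qed

end

section \<open>Sign rules\<close>

lemma psign_0 [simp]: "psign 0 u = u"
  and psign_1 [simp]: "psign 1 u = - u"
  by (simp_all add: psign_def)

lemma psign_minus: "psign p (- u) = - psign p u"
  by (simp add: psign_def)

text \<open>The signs that arise when skew-symmetry is applied before and after \<phi>:
  \<open>k\<close> is the parity of c, \<open>g\<close> that of [a,b], and \<alpha> the degree of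
  \<phi>.\<close>

lemma psign_skew_substitution:
  "- psign (k * g) (- psign (k * (\<alpha> + g)) u + psign (\<alpha> * g) (- psign ((\<alpha> + k) * g) v)) =
    psign (\<alpha> * k) u + v"
  by (cases \<alpha>; cases g; cases k) simp_all

lemma psign_add_times: "psign ((\<alpha> + i) * j) u = psign (i * j) (psign (\<alpha> * j) u)"
  by (cases \<alpha>; cases i; cases j) simp_all

section \<open>The bracket at complex values, trivial centre and perfectness\<close>

context lie_conformal_superalgebra
begin

sublocale complex_poly_module act ..

definition lbr :: "complex \<Rightarrow> 'a \<Rightarrow> 'a \<Rightarrow> 'a"
  where "lbr l a b = ev [:l:] (br a b)"

lemma lbr_add_left: "lbr l (a + a') b = lbr l a b + lbr l a' b"
  by (simp add: lbr_def br_add_left ev_add)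

lemma lbr_add_right: "lbr l a (b + b') = lbr l a b + lbr l a b'"
  by (simp add: lbr_def br_add_right ev_add)

lemma lbr_cmult_left: "lbr l (cmult act c a) b = cmult act c (lbr l a b)"
  by (simp add: lbr_def br_cmult_left ev_map_poly_act)

lemma lbr_cmult_right: "lbr l a (cmult act c b) = cmult act c (lbr l a b)"
  by (simp add: lbr_def br_cmult_right ev_map_poly_act)

lemma lbr_partial_left: "lbr l (partial act a) b = cmult act (- l) (lbr l a b)"
  by (simp add: lbr_def br_partial_left ev_minus ev_pCons flip: scale_minus_left)

lemma lbr_partial_right:
  "lbr l a (partial act b) = partial act (lbr l a b) + cmult act l (lbr l a b)"
  by (simp add: lbr_def br_partial_right ev_add ev_pCons ev_map_poly_act)

lemma lbr_0_left [simp]: "lbr l 0 b = 0"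
  using lbr_add_left[of l 0 0 b] by simp

lemma lbr_0_right [simp]: "lbr l a 0 = 0"
  using lbr_add_right[of l a 0 0] by simp

lemma lbr_minus_left: "lbr l (- a) b = - lbr l a b"
  using lbr_add_left[of l a "- a" b] by (simp add: eq_neg_iff_add_eq_0 add.commute)

lemma lbr_minus_right: "lbr l a (- b) = - lbr l a b"
  using lbr_add_right[of l a b "- b"] by (simp add: eq_neg_iff_add_eq_0 add.commute)

lemma lbr_diff_left: "lbr l (a - a') b = lbr l a b - lbr l a' b"
  using lbr_add_left[of l a "- a'" b] by (simp add: lbr_minus_left)

lemma lbr_diff_right: "lbr l a (b - b') = lbr l a b - lbr l a b'"
  using lbr_add_right[of l a b "- b'"] by (simp add: lbr_minus_right)

lemma lbr_sum_left: "lbr l (sum f A) b = (\<Sum>i\<in>A. lbr l (f i) b)"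
  by (induction A rule: infinite_finite_induct) (auto simp: lbr_add_left)

lemma lbr_sum_right: "lbr l a (sum f A) = (\<Sum>i\<in>A. lbr l a (f i))"
  by (induction A rule: infinite_finite_induct) (auto simp: lbr_add_right)

lemma lbr_psign_left: "lbr l (psign p a) b = psign p (lbr l a b)"
  by (simp add: psign_def lbr_minus_left)

lemma gr_psign: "a \<in> gr i \<Longrightarrow> psign p a \<in> gr i"
  by (simp add: psign_def subspace_neg gr_submodule)

lemma gr_ev: "(\<And>n. coeff p n \<in> gr i) \<Longrightarrow> ev t p \<in> gr i"
  unfolding ev_def by (intro subspace_sum gr_submodule subspace_scale)

lemma gr_lbr: "a \<in> gr i \<Longrightarrow> b \<in> gr j \<Longrightarrow> lbr l a b \<in> gr (i + j)"
  unfolding lbr_def by (intro gr_ev br_graded)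

lemma fev_fbr: "fev s (fbr br V u v) = lbr (sum s V) (fev s u) (fev s v)"
  by (simp add: fbr_def fev_sum fev_mono_mult fev_psubst_lin_mult mval_add fev_def[of s u]
      fev_def[of s v] lbr_sum_left lbr_sum_right lbr_cmult_left lbr_cmult_right
      flip: lbr_def)
    (subst sum.swap, simp add: scale_sum_right mult.commute)

lemma lbr_skew:
  assumes "a \<in> gr i" "b \<in> gr j"
  shows "lbr l a b = - psign (i * j) (ev [:- l, - 1:] (br b a))"
proof -
  let ?s = "\<lambda>_. l"
  have "fev ?s (- lin_mult {Lam} u - Poly_Mapping.map (partial act) u) = act [:- l, - 1:] (fev ?s u)"
    for u
    by (simp add: fev_diff fev_minus fev_lin_mult fev_map
        flip: scale_minus_left scale_left_diff_distrib)
  from fev_psubst[OF this] have "fev ?s (fbr br {Lam} (const a) (const b)) =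
      - psign (i * j) (ev [:- l, - 1:] (br b a))"
    by (simp add: skew_symmetry[OF assms] fev_minus fev_psign)
  then show ?thesis
    by (simp add: fev_fbr)
qed

lemma lbr_jacobi:
  assumes "a \<in> gr i" "b \<in> gr j" "c \<in> gr k"
  shows "lbr l a (lbr m b c) = lbr (l + m) (lbr l a b) c + psign (i * j) (lbr m b (lbr l a c))"
  using arg_cong[OF jacobi[OF assms], of "fev (\<lambda>v. if v = Lam then l else m)"]
  by (simp add: fev_add fev_psign fev_fbr)

lemma ev_br_skew:
  assumes "a \<in> gr i" "b \<in> gr j"
  shows "ev [:- l, - 1:] (br b a) = - psign (i * j) (lbr l a b)"
  by (simp add: lbr_skew[OF assms] psign_def)

lemma br_eq_0_if_lbr: "(\<And>l. lbr l a b = 0) \<Longrightarrow> br a b = 0"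
  by (rule poly_eqI_ev) (simp add: lbr_def)

lemma homogeneous_cases:
  obtains a0 a1 where "a0 \<in> gr 0" "a1 \<in> gr 1" "a = a0 + a1"
  using gr_sum by blast

text \<open>The elements annihilated by all left brackets form an ideal, which is proper as the
  algebra is not abelian, hence zero. Homogeneity of \<open>E\<close> allows skew-symmetry to move
  it to the right.\<close>

lemma centerless:
  assumes simple and E: "E \<in> gr i" and zero: "\<And>l j z. z \<in> gr j \<Longrightarrow> lbr l E z = 0"
  shows "E = 0"
proof -
  define Z where "Z = {w. \<forall>z l. lbr l z w = 0}"
  have "subspace Z"
    by (rule subspace_if_closed_partial)
      (auto simp: Z_def lbr_add_right lbr_cmult_right lbr_partial_right)
  moreover have Z_br: "br z w = 0" if "w \<in> Z" for z w
    using that by (intro br_eq_0_if_lbr) (simp add: Z_def)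
  ultimately have "ideal Z"
    by (auto simp: ideal_def nprod_def subspace_0)
  moreover have "Z \<noteq> UNIV"
    using \<open>simple\<close> Z_br unfolding simple_def abelian_def by blast
  ultimately have "Z = {0}"
    using \<open>simple\<close> unfolding simple_def by blast
  \<comment> \<open>Vanishing at all complex points makes \<open>br E z\<close> the zero polynomial,
    so its value at -l-\<partial> vanishes as well.\<close>
  have hom: "lbr l z E = 0" if "z \<in> gr j" for l z j
    using br_eq_0_if_lbr[OF zero[OF that]] by (simp add: lbr_skew[OF that E] psign_def)
  have "lbr l z E = 0" for l z
    by (rule homogeneous_cases[of z]) (simp add: lbr_add_left hom)
  then have "E \<in> Z"
    by (simp add: Z_def)
  with \<open>Z = {0}\<close> show ?thesis by simp
qed

text \<open>Such an \<open>S\<close> contains all products \<open>nprod n a b\<close> of arbitrary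
  elements, so it is an ideal, and it is nonzero because otherwise the bracket would vanish.\<close>

lemma perfect:
  assumes simple and S: "subspace S"
    and lbr_mem: "\<And>l i j a b. a \<in> gr i \<Longrightarrow> b \<in> gr j \<Longrightarrow> lbr l a b \<in> S"
  shows "S = UNIV"
proof -
  have "lbr l a b \<in> S" for l a b
    by (rule homogeneous_cases[of a], rule homogeneous_cases[of b])
      (auto simp: lbr_add_left lbr_add_right intro!: subspace_add[OF S] lbr_mem)
  then have coeff_mem: "coeff (br a b) n \<in> S" for a b n
    by (intro coeff_in_subspace_if_ev[OF S]) (simp add: lbr_def)
  then have "ideal S"
    using S by (auto simp: ideal_def nprod_def intro: subspace_scale)
  moreover have "S \<noteq> {0}"
  proof
    assume "S = {0}"
    then have "br a b = 0" for a b
      using coeff_mem by (intro poly_eqI) auto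
    then show False
      using \<open>simple\<close> by (simp add: simple_def abelian_def)
  qed
  ultimately show ?thesis
    using \<open>simple\<close> unfolding simple_def by blast
qed

section \<open>Conformal linear maps at complex values\<close>

context
  fixes \<alpha> :: bit and \<phi> :: "'a \<Rightarrow> 'a poly"
  assumes lin: "conformal_linear \<alpha> \<phi>"
begin

definition pev :: "complex \<Rightarrow> 'a \<Rightarrow> 'a"
  where "pev x a = ev [:x:] (\<phi> a)"

lemma pev_add: "pev x (a + b) = pev x a + pev x b"
  using lin by (simp add: pev_def conformal_linear_def ev_add)

lemma pev_cmult: "pev x (cmult act c a) = cmult act c (pev x a)"
  using lin by (simp add: pev_def conformal_linear_def ev_map_poly_act)

lemma pev_partial: "pev x (partial act a) = partial act (pev x a) + cmult act x (pev x a)"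
  using lin by (simp add: pev_def conformal_linear_def ev_add ev_pCons ev_map_poly_act)

lemma gr_pev: "a \<in> gr i \<Longrightarrow> pev x a \<in> gr (\<alpha> + i)"
  using lin unfolding pev_def conformal_linear_def by (intro gr_ev) auto

lemma pev_0 [simp]: "pev x 0 = 0"
  using pev_add[of x 0 0] by simp

lemma pev_minus: "pev x (- a) = - pev x a"
  using pev_add[of x a "- a"] by (simp add: eq_neg_iff_add_eq_0 add.commute)

lemma pev_diff: "pev x (a - b) = pev x a - pev x b"
  using pev_add[of x a "- b"] by (simp add: pev_minus)

lemma pev_sum: "pev x (sum f A) = (\<Sum>i\<in>A. pev x (f i))"
  by (induction A rule: infinite_finite_induct) (auto simp: pev_add)

lemma pev_psign: "pev x (psign p a) = psign p (pev x a)"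
  by (simp add: psign_def pev_minus)

text \<open>Since \<phi> turns \<partial> into \<partial>+x, it carries -n-\<partial> to
  -n-x-\<partial>. This is the intertwining needed to push \<phi> through skew-symmetry.\<close>

lemma pev_act_linear: "pev x (act [:- n, - 1:] a) = act [:- (n + x), - 1:] (pev x a)"
proof -
  have split: "act [:- m, - 1:] u = cmult act (- m) u - partial act u" for m u
    by (simp flip: scale_left_diff_distrib)
  have "pev x (act [:- n, - 1:] a) =
      cmult act (- n) (pev x a) - cmult act x (pev x a) - partial act (pev x a)"
    by (simp only: split pev_diff pev_cmult pev_partial) simp
  then show ?thesis
    by (simp flip: scale_left_diff_distrib)
qed

lemma fev_fmap: "fev s (fmap \<phi> u) = pev (s Ex) (fev s u)"
  by (simp add: fmap_def fev_sum fev_mono_mult fev_psubst_lin_mult fev_def[of s u] pev_sum pev_cmult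
      flip: pev_def)

lemma conformal_derivation_iff:
  "conformal_derivation \<alpha> \<phi> \<longleftrightarrow>
    (\<forall>i j. \<forall>a\<in>gr i. \<forall>b\<in>gr j. \<forall>x m.
      pev x (lbr m a b) = lbr (x + m) (pev x a) b + psign (\<alpha> * i) (lbr m a (pev x b)))"
    (is "_ \<longleftrightarrow> ?R")
proof
  assume D: "conformal_derivation \<alpha> \<phi>"
  show ?R
  proof (intro allI ballI)
    fix i j a b x m
    assume "a \<in> gr i" "b \<in> gr j"
    with D have "fmap \<phi> (fbr br {Mu} (const a) (const b)) =
         fbr br {Ex, Mu} (fmap \<phi> (const a)) (const b)
         + psign (\<alpha> * i) (fbr br {Mu} (const a) (fmap \<phi> (const b)))"
      unfolding conformal_derivation_def by blast
    from arg_cong[OF this, of "fev (\<lambda>v. if v = Ex then x else m)"]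
    show "pev x (lbr m a b) = lbr (x + m) (pev x a) b + psign (\<alpha> * i) (lbr m a (pev x b))"
      by (simp add: fev_add fev_psign fev_fbr fev_fmap)
  qed
next
  assume R: ?R
  show "conformal_derivation \<alpha> \<phi>"
    unfolding conformal_derivation_def
  proof (intro conjI lin allI ballI fpoly_eqI_fev)
    fix i j a b s
    assume "a \<in> gr i" "b \<in> gr j"
    with R have "pev (s Ex) (lbr (s Mu) a b) = lbr (s Ex + s Mu) (pev (s Ex) a) b
        + psign (\<alpha> * i) (lbr (s Mu) a (pev (s Ex) b))"
      by blast
    then show "fev s (fmap \<phi> (fbr br {Mu} (const a) (const b))) = fev s (
         fbr br {Ex, Mu} (fmap \<phi> (const a)) (const b)
         + psign (\<alpha> * i) (fbr br {Mu} (const a) (fmap \<phi> (const b))))"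
      by (simp add: fev_add fev_psign fev_fbr fev_fmap)
  qed
qed

lemma conformal_triple_derivation_iff:
  "conformal_triple_derivation \<alpha> \<phi> \<longleftrightarrow>
    (\<forall>i j k. \<forall>a\<in>gr i. \<forall>b\<in>gr j. \<forall>c\<in>gr k. \<forall>x l m.
      pev x (lbr (l + m) (lbr l a b) c) =
        lbr (l + m + x) (lbr (l + x) (pev x a) b) c
        + psign (\<alpha> * i) (lbr (l + m + x) (lbr l a (pev x b)) c)
        + psign (\<alpha> * (i + j)) (lbr (l + m) (lbr l a b) (pev x c)))"
    (is "_ \<longleftrightarrow> ?R")
proof
  assume D: "conformal_triple_derivation \<alpha> \<phi>"
  show ?R
  proof (intro allI ballI)
    fix i j k a b c x l m
    assume "a \<in> gr i" "b \<in> gr j" "c \<in> gr k"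
    with D have "fmap \<phi> (fbr br {Lam, Mu} (fbr br {Lam} (const a) (const b)) (const c)) =
         fbr br {Lam, Mu, Ex} (fbr br {Lam, Ex} (fmap \<phi> (const a)) (const b)) (const c)
         + psign (\<alpha> * i)
             (fbr br {Lam, Mu, Ex} (fbr br {Lam} (const a) (fmap \<phi> (const b))) (const c))
         + psign (\<alpha> * (i + j))
             (fbr br {Lam, Mu} (fbr br {Lam} (const a) (const b)) (fmap \<phi> (const c)))"
      unfolding conformal_triple_derivation_def by blast
    from arg_cong[OF this, of "fev (\<lambda>v. if v = Ex then x else if v = Lam then l else m)"]
    show "pev x (lbr (l + m) (lbr l a b) c) =
        lbr (l + m + x) (lbr (l + x) (pev x a) b) c
        + psign (\<alpha> * i) (lbr (l + m + x) (lbr l a (pev x b)) c)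
        + psign (\<alpha> * (i + j)) (lbr (l + m) (lbr l a b) (pev x c))"
      by (simp add: fev_add fev_psign fev_fbr fev_fmap add.assoc)
  qed
next
  assume R: ?R
  show "conformal_triple_derivation \<alpha> \<phi>"
    unfolding conformal_triple_derivation_def
  proof (intro conjI lin allI ballI fpoly_eqI_fev)
    fix i j k a b c s
    assume "a \<in> gr i" "b \<in> gr j" "c \<in> gr k"
    with R have "pev (s Ex) (lbr (s Lam + s Mu) (lbr (s Lam) a b) c) =
        lbr (s Lam + s Mu + s Ex) (lbr (s Lam + s Ex) (pev (s Ex) a) b) c
        + psign (\<alpha> * i) (lbr (s Lam + s Mu + s Ex) (lbr (s Lam) a (pev (s Ex) b)) c)
        + psign (\<alpha> * (i + j)) (lbr (s Lam + s Mu) (lbr (s Lam) a b) (pev (s Ex) c))"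
      by blast
    then show "fev s (fmap \<phi> (fbr br {Lam, Mu} (fbr br {Lam} (const a) (const b)) (const c))) =
      fev s (fbr br {Lam, Mu, Ex} (fbr br {Lam, Ex} (fmap \<phi> (const a)) (const b)) (const c)
         + psign (\<alpha> * i)
             (fbr br {Lam, Mu, Ex} (fbr br {Lam} (const a) (fmap \<phi> (const b))) (const c))
         + psign (\<alpha> * (i + j))
             (fbr br {Lam, Mu} (fbr br {Lam} (const a) (const b)) (fmap \<phi> (const c))))"
      by (simp add: fev_add fev_psign fev_fbr fev_fmap add.assoc)
  qed
qed

text \<open>The derivation rule is applied to the outer bracket and then to the inner one.\<close>

lemma triple_derivation_if_derivation:
  assumes "conformal_derivation \<alpha> \<phi>"
  shows "conformal_triple_derivation \<alpha> \<phi>"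
  unfolding conformal_triple_derivation_iff
proof (intro allI ballI)
  fix i j k a b c x l m
  assume gr: "a \<in> gr i" "b \<in> gr j" "c \<in> gr k"
  have der: "pev x (lbr m a b) = lbr (x + m) (pev x a) b + psign (\<alpha> * i) (lbr m a (pev x b))"
    if "a \<in> gr i" "b \<in> gr j" for i j a b x m
    using assms that unfolding conformal_derivation_iff by blast
  show "pev x (lbr (l + m) (lbr l a b) c) =
        lbr (l + m + x) (lbr (l + x) (pev x a) b) c
        + psign (\<alpha> * i) (lbr (l + m + x) (lbr l a (pev x b)) c)
        + psign (\<alpha> * (i + j)) (lbr (l + m) (lbr l a b) (pev x c))"
    by (simp add: der[OF gr_lbr[OF gr(1,2)] gr(3)] der[OF gr(1,2)] lbr_add_left lbr_psign_left
        ac_simps)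
qed

section \<open>The defect of a conformal linear map from being a derivation\<close>

text \<open>\<open>i\<close> is the parity of \<open>a\<close>.\<close>

definition defect :: "complex \<Rightarrow> complex \<Rightarrow> bit \<Rightarrow> 'a \<Rightarrow> 'a \<Rightarrow> 'a"
  where "defect x n i a b =
    pev x (lbr n a b) - lbr (n + x) (pev x a) b - psign (\<alpha> * i) (lbr n a (pev x b))"

lemma defect_add_left: "defect x n i (a + a') b = defect x n i a b + defect x n i a' b"
  by (simp add: defect_def lbr_add_left pev_add psign_def)

lemma defect_add_right: "defect x n i a (b + b') = defect x n i a b + defect x n i a b'"
  by (simp add: defect_def lbr_add_right pev_add psign_def)

lemma defect_0_left [simp]: "defect x n i 0 b = 0"
  using defect_add_left[of x n i 0 0 b] by simp

lemma defect_0_right [simp]: "defect x n i a 0 = 0"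
  using defect_add_right[of x n i a 0 0] by simp

lemma defect_minus_left: "defect x n i (- a) b = - defect x n i a b"
  using defect_add_left[of x n i a "- a" b] by (simp add: eq_neg_iff_add_eq_0 add.commute)

lemma defect_psign_left: "defect x n i (psign p a) b = psign p (defect x n i a b)"
  by (simp add: psign_def defect_minus_left)

lemma defect_cmult_left: "defect x n i (cmult act c a) b = cmult act c (defect x n i a b)"
  by (simp add: defect_def lbr_cmult_left pev_cmult psign_def scale_right_diff_distrib
      scale_right_distrib)

lemma defect_cmult_right: "defect x n i a (cmult act c b) = cmult act c (defect x n i a b)"
  by (simp add: defect_def lbr_cmult_right pev_cmult psign_def scale_right_diff_distrib
      scale_right_distrib)

text \<open>The defect is sesquilinear like the bracket, so its zeros in either argument are closed
  under \<partial>.\<close>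

lemma defect_partial_left: "defect x n i (partial act a) b = cmult act (- n) (defect x n i a b)"
proof -
  have "lbr (n + x) (pev x (partial act a)) b = cmult act (- n) (lbr (n + x) (pev x a) b)"
    by (simp only: pev_partial lbr_add_left lbr_partial_left lbr_cmult_left)
      (simp flip: scale_left_distrib)
  then show ?thesis
    by (simp add: defect_def lbr_partial_left pev_cmult psign_def scale_right_diff_distrib
        scale_right_distrib)
qed

lemma defect_partial_right:
  "defect x n i a (partial act b) = act [:n + x, 1:] (defect x n i a b)"
proof -
  have cmult_add: "cmult act (n + x) u = cmult act n u + cmult act x u" for u
    by (simp flip: scale_left_distrib)
  have act_linear: "act [:n + x, 1:] u = partial act u + (cmult act n u + cmult act x u)" for u
    by (simp flip: scale_left_distrib)
  show ?thesis
    by (simp add: defect_def lbr_partial_right pev_add pev_cmult pev_partial lbr_add_right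
        lbr_cmult_right psign_def scale_right_diff_distrib scale_right_distrib cmult_add act_linear
        del: scale_scale)
qed

text \<open>Needed because skew-symmetry, the Jacobi identity and \<open>centerless\<close> are
  applied to defects, and each asks for homogeneous elements.\<close>

lemma gr_defect:
  assumes a: "a \<in> gr i" and b: "b \<in> gr j"
  shows "defect x n i a b \<in> gr (\<alpha> + (i + j))"
proof -
  have "pev x (lbr n a b) \<in> gr (\<alpha> + (i + j))"
    by (intro gr_pev gr_lbr a b)
  moreover have "lbr (n + x) (pev x a) b \<in> gr (\<alpha> + (i + j))"
    using gr_lbr[OF gr_pev[OF a] b] by (simp only: add.assoc)
  moreover have "lbr n a (pev x b) \<in> gr (\<alpha> + (i + j))"
    using gr_lbr[OF a gr_pev[OF b]] by (simp only: add.left_commute)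
  ultimately show ?thesis
    unfolding defect_def by (intro subspace_diff gr_psign gr_submodule)
qed

section \<open>The defect of a triple derivation vanishes\<close>

context
  assumes triple: "conformal_triple_derivation \<alpha> \<phi>"
begin

text \<open>The triple rule expands the first term of the defect; what survives is the bracket with
  c of the two derivation terms minus \<phi>[a,b].\<close>

lemma defect_lbr_left:
  assumes "a \<in> gr i" "b \<in> gr j" "c \<in> gr k"
  shows "defect x n (i + j) (lbr l a b) c = - lbr (n + x) (defect x l i a b) c"
proof -
  \<comment> \<open>The value \<open>n - l\<close> for \<mu> makes the outer variable
    \<lambda>+\<mu> equal to the arbitrary \<open>n\<close>.\<close>
  have "pev x (lbr (l + (n - l)) (lbr l a b) c) =
        lbr (l + (n - l) + x) (lbr (l + x) (pev x a) b) c
        + psign (\<alpha> * i) (lbr (l + (n - l) + x) (lbr l a (pev x b)) c)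
        + psign (\<alpha> * (i + j)) (lbr (l + (n - l)) (lbr l a b) (pev x c))"
    using triple assms unfolding conformal_triple_derivation_iff by blast
  then show ?thesis
    by (simp add: defect_def lbr_diff_left lbr_psign_left)
qed

text \<open>
  By skew-symmetry this is the previous identity with the formal operator \<open>-n-x-\<partial>\<close> substituted
  for its variable \<open>n\<close>.
\<close>

lemma defect_lbr_right:
  assumes a: "a \<in> gr i" and b: "b \<in> gr j" and c: "c \<in> gr k"
  shows "defect x n k c (lbr l a b) = - psign (\<alpha> * k) (lbr n c (defect x l i a b))"
proof -
  define w where "w = lbr l a b"
  define d where "d = defect x l i a b"
  have w: "w \<in> gr (i + j)"
    unfolding w_def using a b by (rule gr_lbr)
  have u: "pev x w - d \<in> gr (\<alpha> + (i + j))"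
    unfolding d_def using gr_defect[OF a b] gr_pev[OF w] gr_submodule
    by (intro subspace_diff)
  have pc: "pev x c \<in> gr (\<alpha> + k)"
    using c by (rule gr_pev)
  obtain q where q: "\<And>t. ev t q = ev (t + [:x:]) (br (pev x w - d) c)"
    using ev_shift by blast
  \<comment> \<open>The preceding lemma holds at all complex points, so it is an equality of
    polynomials and may be evaluated at points involving \<partial>.\<close>
  have "map_poly (pev x) (br w c) = q + psign (\<alpha> * (i + j)) (br w (pev x c))"
  proof (rule poly_eqI_ev)
    fix m
    have move: "p = q - s + r" if "p - q - r = - s" for p q r s :: 'a
      using that by (simp add: algebra_simps)
    have "pev x (lbr m w c) =
        lbr (m + x) (pev x w - d) c + psign (\<alpha> * (i + j)) (lbr m w (pev x c))"
      using defect_lbr_left[OF a b c, of x m l]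
      unfolding w_def[symmetric] d_def[symmetric] defect_def[of _ m] lbr_diff_left
      by (rule move)
    then show "ev [:m:] (map_poly (pev x) (br w c)) =
        ev [:m:] (q + psign (\<alpha> * (i + j)) (br w (pev x c)))"
      by (simp only: ev_map_poly[of "pev x" "[:m:]", OF pev_add pev_cmult] ev_add ev_psign q
          lbr_def add_pCons add_0_right)
  qed
  \<comment> \<open>Evaluation at -n-x-\<partial>: on the left \<phi> moves outside and the point
    becomes -n-\<partial>, while the translation built into \<open>q\<close> adds back x.\<close>
  then have eq: "pev x (ev [:- n, - 1:] (br w c)) = ev [:- n, - 1:] (br (pev x w - d) c)
      + psign (\<alpha> * (i + j)) (ev [:- (n + x), - 1:] (br w (pev x c)))"
    by (simp add: ev_map_poly[of "pev x", OF pev_add pev_act_linear, symmetric] ev_add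
        ev_psign q)
  have "pev x (lbr n c w) = - psign (k * (i + j)) (pev x (ev [:- n, - 1:] (br w c)))"
    by (simp only: lbr_skew[OF c w] pev_minus pev_psign)
  also have "\<dots> = psign (\<alpha> * k) (lbr n c (pev x w - d)) + lbr (n + x) (pev x c) w"
    by (simp only: eq ev_br_skew[OF c u] ev_br_skew[OF pc w] psign_skew_substitution)
  finally have "pev x (lbr n c w) =
      psign (\<alpha> * k) (lbr n c (pev x w - d)) + lbr (n + x) (pev x c) w" .
  then show ?thesis
    by (simp add: defect_def[of _ n] w_def[symmetric] d_def[symmetric] lbr_diff_right psign_def)
qed

text \<open>With trivial centre it suffices to bracket the difference \<open>E\<close> with every z.
  There each D(u,v) is replaced by -D([u,v],z), and additivity in the first argument leaves the
  defect of a Jacobi sum, which is zero.\<close>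

lemma defect_cocycle:
  assumes simple and a: "a \<in> gr i" and b: "b \<in> gr j" and c: "c \<in> gr k"
  shows "defect x l i a (lbr m b c) = defect x (l + m) (i + j) (lbr l a b) c
    + psign (i * j) (defect x m j b (lbr l a c))"
proof -
  define E where "E = defect x (l + m) (i + j) (lbr l a b) c
    + psign (i * j) (defect x m j b (lbr l a c)) - defect x l i a (lbr m b c)"
  have "E \<in> gr (\<alpha> + (i + j + k))"
  proof -
    have "defect x (l + m) (i + j) (lbr l a b) c \<in> gr (\<alpha> + (i + j + k))"
      by (intro gr_defect gr_lbr a b c)
    moreover have "defect x m j b (lbr l a c) \<in> gr (\<alpha> + (i + j + k))"
      using gr_defect[OF b gr_lbr[OF a c]] by (simp only: ac_simps)
    moreover have "defect x l i a (lbr m b c) \<in> gr (\<alpha> + (i + j + k))"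
      using gr_defect[OF a gr_lbr[OF b c]] by (simp only: ac_simps)
    ultimately show ?thesis
      unfolding E_def by (intro subspace_diff subspace_add gr_psign gr_submodule)
  qed
  moreover have "lbr n E z = 0" if "z \<in> gr h" for n h z
  proof -
    \<comment> \<open>The shift to \<open>n - x\<close> cancels the x that
      \<open>defect_lbr_left\<close> adds to the bracket variable.\<close>
    have left: "lbr n (defect x p g u v) z = - defect x (n - x) (g + h') (lbr p u v) z"
      if "u \<in> gr g" "v \<in> gr h'" for p g h' u v
      using defect_lbr_left[OF that \<open>z \<in> gr h\<close>, of x "n - x" p] by simp
    \<comment> \<open>The three defects must carry the same parity argument before additivity can
      merge them.\<close>
    have parity: "j + (i + k) = i + j + k" "i + (j + k) = i + j + k"
      by (simp_all only: ac_simps)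
    have "lbr n E z = - (defect x (n - x) (i + j + k) (lbr (l + m) (lbr l a b) c
          + psign (i * j) (lbr m b (lbr l a c))) z)
        + defect x (n - x) (i + j + k) (lbr l a (lbr m b c)) z"
      by (simp only: E_def lbr_diff_left lbr_add_left lbr_psign_left left[OF gr_lbr[OF a b] c]
          left[OF b gr_lbr[OF a c]] left[OF a gr_lbr[OF b c]] parity defect_add_left
          defect_psign_left psign_minus minus_add_distrib diff_minus_eq_add)
    then show ?thesis
      by (simp only: lbr_jacobi[OF a b c] left_minus)
  qed
  ultimately have "E = 0"
    using centerless[OF \<open>simple\<close>] by blast
  then show ?thesis
    by (simp add: E_def)
qed

text \<open>The Jacobi identity for the defect \<open>Q\<close> of the pair \<open>a1\<close>,
  \<open>a2\<close> and the cocycle identity compute the same expression with opposite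
  signs.\<close>

lemma defect_lbr_lbr_eq_0:
  assumes simple and a1: "a1 \<in> gr i1" and a2: "a2 \<in> gr i2" and b: "b \<in> gr j" and c: "c \<in> gr k"
  shows "defect x l (i1 + i2) (lbr p a1 a2) (lbr m b c) = 0"
proof -
  define i where "i = i1 + i2"
  define a where "a = lbr p a1 a2"
  define Q where "Q = defect x p i1 a1 a2"
  have a: "a \<in> gr i"
    unfolding a_def i_def using a1 a2 by (rule gr_lbr)
  have Q: "Q \<in> gr (\<alpha> + i)"
    unfolding Q_def i_def using a1 a2 by (rule gr_defect)
  have lbr_Q: "lbr (l + x) Q y = - defect x l i a y" if "y \<in> gr h" for h y
    using defect_lbr_left[OF a1 a2 that] by (simp add: a_def Q_def i_def)
  have "- defect x l i a (lbr m b c) = lbr (l + x) Q (lbr m b c)"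
    by (simp add: lbr_Q[OF gr_lbr[OF b c]])
  also have "\<dots> = lbr (l + x + m) (lbr (l + x) Q b) c
      + psign ((\<alpha> + i) * j) (lbr m b (lbr (l + x) Q c))"
    by (rule lbr_jacobi[OF Q b c])
  also have "\<dots> = - lbr (l + m + x) (defect x l i a b) c
      - psign ((\<alpha> + i) * j) (lbr m b (defect x l i a c))"
    by (simp only: lbr_Q[OF b] lbr_Q[OF c] lbr_minus_left lbr_minus_right psign_minus
        add.assoc add.commute[of x m] diff_conv_add_uminus)
  also have "\<dots> = defect x (l + m) (i + j) (lbr l a b) c
      + psign (i * j) (defect x m j b (lbr l a c))"
    \<comment> \<open>The Jacobi sign splits into the signs for \<open>i * j\<close> and
      \<open>\<alpha> * j\<close>; the latter is exactly the one produced by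
      \<open>defect_lbr_right\<close>.\<close>
    unfolding defect_lbr_left[OF a b c] defect_lbr_right[OF a c b]
    by (simp only: psign_add_times psign_minus diff_conv_add_uminus)
  also have "\<dots> = defect x l i a (lbr m b c)"
    by (rule defect_cocycle[OF \<open>simple\<close> a b c, symmetric])
  finally have neg: "- defect x l i a (lbr m b c) = defect x l i a (lbr m b c)" .
  \<comment> \<open>An element equal to its own negative is killed by the constant 2, which is
    invertible in \<complex>[\<partial>].\<close>
  have two: "[:2:] = (1 + 1 :: complex poly)"
    by (simp add: one_pCons)
  have "cmult act 2 (defect x l i a (lbr m b c)) = 0"
    unfolding two scale_left_distrib scale_one by (metis neg left_minus)
  then have "cmult act (1 / 2) (cmult act 2 (defect x l i a (lbr m b c))) = 0"
    by (simp only: scale_zero_right)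
  then have "defect x l i a (lbr m b c) = 0"
    unfolding scale_scale by (simp flip: one_pCons)
  then show ?thesis
    by (simp only: a_def i_def)
qed

text \<open>Perfectness is used twice, first to free the second argument from being a bracket, then
  the first.\<close>

lemma defect_eq_0:
  assumes simple and a: "a \<in> gr i"
  shows "defect x n i a b = 0"
proof -
  have lbr_left: "defect x n (i1 + i2) (lbr p a1 a2) y = 0"
    if "a1 \<in> gr i1" "a2 \<in> gr i2" for i1 i2 p a1 a2 y
  proof -
    let ?S = "{y. defect x n (i1 + i2) (lbr p a1 a2) y = 0}"
    have "subspace ?S"
      by (rule subspace_if_closed_partial)
        (auto simp: defect_add_right defect_cmult_right defect_partial_right)
    then have "?S = UNIV"
      by (rule perfect[OF \<open>simple\<close>]) (use \<open>simple\<close> that defect_lbr_lbr_eq_0 in blast)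
    then show ?thesis by blast
  qed
  \<comment> \<open>The defect takes the parity of its first argument as a parameter, so zeros are
    collected separately in each degree and then summed.\<close>
  define K where "K j = {a \<in> gr j. defect x n j a b = 0}" for j
  have K: "subspace (K j)" for j
    by (rule subspace_if_closed_partial)
      (use gr_submodule[of j] in \<open>auto simp: K_def defect_add_left defect_cmult_left
        defect_partial_left subspace_0 subspace_add subspace_scale\<close>)
  let ?S = "{a0 + a1 | a0 a1. a0 \<in> K 0 \<and> a1 \<in> K 1}"
  have "subspace ?S"
    by (intro subspace_sums K)
  moreover have "lbr l u v \<in> ?S" if "u \<in> gr g" "v \<in> gr h" for l u v g h
  proof -
    have "lbr l u v \<in> K (g + h)"
      using that gr_lbr lbr_left unfolding K_def by blast
    then have "lbr l u v \<in> K 0 \<or> lbr l u v \<in> K 1"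
      by (cases "g + h") (simp_all only: simp_thms)
    then show ?thesis
      using subspace_0[OF K]
      by (metis (mono_tags, lifting) CollectI add.left_neutral add.right_neutral)
  qed
  ultimately have "?S = UNIV"
    by (rule perfect[OF \<open>simple\<close>])
  then obtain a0 a1 where K01: "a0 \<in> K 0" "a1 \<in> K 1" and a_eq: "a = a0 + a1"
    by blast
  then have gr01: "a0 \<in> gr 0" "a1 \<in> gr 1"
    by (auto simp: K_def)
  \<comment> \<open>The decomposition need not be known in advance to be the graded one: the
    component of the other parity lies in both degrees and is therefore 0.\<close>
  have "a \<in> K i"
  proof (cases "i = 0")
    case True
    have "a1 = a - a0" by (simp add: a_eq)
    then have "a1 \<in> gr 0 \<inter> gr 1"
      using a gr01 True by (auto intro: subspace_diff gr_submodule)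
    then show ?thesis using gr_inter K01 a_eq True by simp
  next
    case False
    then have 1: "i = 1" by simp
    have "a0 = a - a1" by (simp add: a_eq)
    then have "a0 \<in> gr 0 \<inter> gr 1"
      using a gr01 1 by (auto intro: subspace_diff gr_submodule)
    then show ?thesis using gr_inter K01 a_eq 1 by simp
  qed
  then show ?thesis
    by (simp add: K_def)
qed

lemma derivation_if_triple_derivation:
  assumes simple
  shows "conformal_derivation \<alpha> \<phi>"
  unfolding conformal_derivation_iff
proof (intro allI ballI)
  fix i j a b x m
  assume "a \<in> gr i" "b \<in> gr j"
  then show "pev x (lbr m a b) = lbr (x + m) (pev x a) b + psign (\<alpha> * i) (lbr m a (pev x b))"
    using defect_eq_0[OF assms, of a i x m b] by (simp add: defect_def algebra_simps)
qed

end

end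

text \<open>Both notions include conformal linearity, so for other maps both sides are
  false.\<close>

lemma conformal_triple_derivation_iff_derivation:
  assumes simple
  shows "conformal_triple_derivation \<alpha> \<phi> \<longleftrightarrow> conformal_derivation \<alpha> \<phi>"
proof (cases "conformal_linear \<alpha> \<phi>")
  case True
  show ?thesis
    using triple_derivation_if_derivation[OF True] derivation_if_triple_derivation[OF True _ assms]
    by blast
qed (simp add: conformal_triple_derivation_def conformal_derivation_def)

end

theorem theorem4p4:
  fixes act :: "complex poly \<Rightarrow> 'a::ab_group_add \<Rightarrow> 'a"
    and gr :: "bit \<Rightarrow> 'a set"
    and br :: "'a \<Rightarrow> 'a \<Rightarrow> 'a poly"
  assumes "lie_conformal_superalgebra act gr br"
    and "lie_conformal_superalgebra.fin_gen act"
    and "lie_conformal_superalgebra.simple act br"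
  shows "(\<forall>\<alpha> \<phi>. lie_conformal_superalgebra.conformal_triple_derivation act gr br \<alpha> \<phi> \<longleftrightarrow>
            lie_conformal_superalgebra.conformal_derivation act gr br \<alpha> \<phi>) \<and>
         lie_conformal_superalgebra.CTDer act gr br = lie_conformal_superalgebra.CDer act gr br"
proof -
  interpret lie_conformal_superalgebra act gr br
    by fact
  show ?thesis
    \<comment> \<open>Both spaces consist of sums of an even and an odd member, so the equivalence
      in each degree gives equality.\<close>
    by (simp add: CTDer_def CDer_def conformal_triple_derivation_iff_derivation[OF assms(3)])
qed

end
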